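(* Let $f(x)=\tfrac12x^\top Qx-p^\top x+r$ on $\mathbb{R}^d$, where $Q$ is symmetric positive definite with eigenvalues $0<\mu=\lambda_1\le\lambda_2\le\dots\le\lambda_d=L$. Consider the noisy accelerated gradient (AG) iterations $$y_k=(1+\beta)x_k-\beta x_{k-1},\qquad x_{k+1}=y_k-\alpha(\nabla f(y_k)+w_k),$$ with parameters $(\alpha,\beta)\in\mathcal{S}$ (the stability region defined in the context), where the noise $\{w_k\}$ satisfies the noise assumption of the context. Then the robustness of AG is $$\mathcal{J}(\alpha,\beta)=\sum_{i=1}^d u_{\alpha,\beta}(\lambda_i),\qquad u_{\alpha,\beta}(\lambda)=\alpha\,\frac{1+\beta(1-\alpha\lambda)}{2\left(1-\beta(1-\alpha\lambda)\right)\left(2+2\beta-\alpha\lambda(1+2\beta)\right)}.$$ In the special case $\beta=0$, this reduces to the gradient descent formula $\mathcal{J}(\alpha)=\alpha\sum_{i=1}^d\frac{1}{2(2-\alpha\lambda_i)}$.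
   Context: $\mathcal{S}=\{(\alpha,\beta):\rho(A_Q)<1,\ \alpha\ge0,\ \beta\ge0\}$, where $\rho$ denotes spectral radius and $A_Q=\begin{bmatrix}(1+\beta)(I_d-\alpha Q)&-\beta(I_d-\alpha Q)\\ I_d&0_d\end{bmatrix}$. Noise assumption: for some $\sigma>0$ and every $k\ge0$, the random vector $w_k\in\mathbb{R}^d$ has zero mean, is independent of $\{(x_i,x_{i-1})\}_{i=1}^k$ and $\{y_i\}_{i=1}^k$, and $\mathbb{E}[w_kw_k^\top]=\sigma^2I_d$; the initial points $x_0,x_{-1}$ are deterministic. The robustness of the algorithm is $\mathcal{J}=\limsup_{k\to\infty}\frac1{\sigma^2}\mathbb{E}[f(x_k)-f^*]$ with $f^*=\min f$ (for quadratic $f$ and $(\alpha,\beta)\in\mathcal{S}$ the limsup is a limit). *)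

theory Defs
  imports "HOL-Probability.Probability"
begin

section \<open>Matrices\<close>

definition sym_pos_def :: "real^'n^'n \<Rightarrow> bool" where
  "sym_pos_def Q \<longleftrightarrow> transpose Q = Q \<and> (\<forall>v. v \<noteq> 0 \<longrightarrow> 0 < v \<bullet> (Q *v v))"

text \<open>The eigenvalues, listed in nondecreasing order and with multiplicity as the entries
  \<open>1, \<dots>, CARD('n)\<close> of \<open>lam\<close>; the product is the factored characteristic polynomial.\<close>

definition ordered_eigenvalues :: "real^'n^'n \<Rightarrow> (nat \<Rightarrow> real) \<Rightarrow> bool" where
  "ordered_eigenvalues Q lam \<longleftrightarrow>
     mono_on {1..CARD('n)} lam \<and>
     (\<forall>z. det (mat z - Q) = (\<Prod>i = 1..CARD('n). z - lam i))"

text \<open>The eigenvalues here are complex: the matrix it is applied to is not symmetric.\<close>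

definition complex_eigenvalue :: "real^'m^'m \<Rightarrow> complex \<Rightarrow> bool" where
  "complex_eigenvalue A z \<longleftrightarrow>
     (\<exists>v. v \<noteq> 0 \<and> (\<chi> i j. complex_of_real (A $ i $ j)) *v v = z *s v)"

definition spectral_radius :: "real^'m^'m \<Rightarrow> real" where
  "spectral_radius A = Max (norm ` {z. complex_eigenvalue A z})"

definition block_matrix ::
  "real^'n^'n \<Rightarrow> real^'n^'n \<Rightarrow> real^'n^'n \<Rightarrow> real^'n^'n \<Rightarrow> real^('n + 'n)^('n + 'n)" where
  "block_matrix A B C D =
     (\<chi> i j. case i of
        Inl a \<Rightarrow> (case j of Inl b \<Rightarrow> A $ a $ b | Inr b \<Rightarrow> B $ a $ b)
      | Inr a \<Rightarrow> (case j of Inl b \<Rightarrow> C $ a $ b | Inr b \<Rightarrow> D $ a $ b))"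

section \<open>Accelerated gradient with noise\<close>

definition AG_matrix :: "real \<Rightarrow> real \<Rightarrow> real^'n^'n \<Rightarrow> real^('n + 'n)^('n + 'n)" where
  "AG_matrix \<alpha> \<beta> Q =
     block_matrix ((1 + \<beta>) *\<^sub>R (mat 1 - \<alpha> *\<^sub>R Q)) ((- \<beta>) *\<^sub>R (mat 1 - \<alpha> *\<^sub>R Q))
                  (mat 1) 0"

definition stability_region :: "real^'n^'n \<Rightarrow> (real \<times> real) set" where
  "stability_region Q = {(\<alpha>, \<beta>). spectral_radius (AG_matrix \<alpha> \<beta> Q) < 1 \<and> \<alpha> \<ge> 0 \<and> \<beta> \<ge> 0}"

definition gradient :: "('b::real_inner \<Rightarrow> real) \<Rightarrow> 'b \<Rightarrow> 'b" where
  "gradient f x = (THE D. GDERIV f x :> D)"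

text \<open>The iterates \<open>x\<close> are indexed by integers because the recursion starts from
  \<open>x 0\<close> and \<open>x (- 1)\<close>; values of \<open>x\<close> below index \<open>- 1\<close> play no role.\<close>

definition AG_iterates ::
  "'a measure \<Rightarrow> (real^'n \<Rightarrow> real) \<Rightarrow> real \<Rightarrow> real \<Rightarrow> (nat \<Rightarrow> 'a \<Rightarrow> real^'n) \<Rightarrow>
   (int \<Rightarrow> 'a \<Rightarrow> real^'n) \<Rightarrow> (nat \<Rightarrow> 'a \<Rightarrow> real^'n) \<Rightarrow> bool" where
  "AG_iterates M f \<alpha> \<beta> w x y \<longleftrightarrow>
     (\<forall>k. \<forall>\<omega>\<in>space M.
        y k \<omega> = (1 + \<beta>) *\<^sub>R x (int k) \<omega> - \<beta> *\<^sub>R x (int k - 1) \<omega> \<and>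
        x (int k + 1) \<omega> = y k \<omega> - \<alpha> *\<^sub>R (gradient f (y k \<omega>) + w k \<omega>))"

text \<open>Same as the library's \<open>prob_space.indep_var\<close>, which however requires both random
  variables to take values in the same type.\<close>

definition independent_rvs ::
  "'a measure \<Rightarrow> 'b measure \<Rightarrow> ('a \<Rightarrow> 'b) \<Rightarrow> 'c measure \<Rightarrow> ('a \<Rightarrow> 'c) \<Rightarrow> bool" where
  "independent_rvs M S X T Y \<longleftrightarrow>
     X \<in> measurable M S \<and> Y \<in> measurable M T \<and>
     prob_space.indep_set M {X -` A \<inter> space M | A. A \<in> sets S} {Y -` B \<inter> space M | B. B \<in> sets T}"

text \<open>The past of the algorithm at step \<open>k\<close> is the single random element consisting of all
  \<open>(x i, x (i - 1))\<close> and \<open>y i\<close> with \<open>1 \<le> i \<le> k\<close>, so independence of it is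
  independence of the joint history. The second moment is the integral of the matrix-valued
  function \<open>w w\<^sup>T\<close>; since \<open>\<sigma>\<^sup>2 \<noteq> 0\<close>, it is zero (hence not \<open>mat (\<sigma>\<^sup>2)\<close>) when that function
  is not integrable.\<close>

definition noise_assumption ::
  "'a measure \<Rightarrow> real \<Rightarrow> (nat \<Rightarrow> 'a \<Rightarrow> real^'n) \<Rightarrow>
   (int \<Rightarrow> 'a \<Rightarrow> real^'n) \<Rightarrow> (nat \<Rightarrow> 'a \<Rightarrow> real^'n) \<Rightarrow> bool" where
  "noise_assumption M \<sigma> w x y \<longleftrightarrow>
     \<sigma> > 0 \<and>
     (\<forall>k. w k \<in> borel_measurable M \<and>
          integrable M (w k) \<and> integral\<^sup>L M (w k) = 0 \<and>
          independent_rvs M borel (w k)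
            (\<Pi>\<^sub>M i\<in>{1..k}. borel :: (((real^'n) \<times> (real^'n)) \<times> (real^'n)) measure)
            (\<lambda>\<omega>. \<lambda>i\<in>{1..k}. ((x (int i) \<omega>, x (int i - 1) \<omega>), y i \<omega>)) \<and>
          integral\<^sup>L M (\<lambda>\<omega>. (\<chi> i j. w k \<omega> $ i * w k \<omega> $ j) :: real^'n^'n) = mat (\<sigma>\<^sup>2)) \<and>
     (\<exists>c. \<forall>\<omega>\<in>space M. x 0 \<omega> = c) \<and> (\<exists>c. \<forall>\<omega>\<in>space M. x (- 1) \<omega> = c)"

definition min_value :: "('b \<Rightarrow> real) \<Rightarrow> real" where
  "min_value f = (LEAST m. m \<in> range f)"

definition robustness ::
  "'a measure \<Rightarrow> real \<Rightarrow> ('b \<Rightarrow> real) \<Rightarrow> (nat \<Rightarrow> 'a \<Rightarrow> 'b) \<Rightarrow> ereal" where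
  "robustness M \<sigma> f x =
     limsup (\<lambda>k. ereal (1 / \<sigma>\<^sup>2 * integral\<^sup>L M (\<lambda>\<omega>. f (x k \<omega>) - min_value f)))"

definition u_AG :: "real \<Rightarrow> real \<Rightarrow> real \<Rightarrow> real" where
  "u_AG \<alpha> \<beta> l =
     \<alpha> * ((1 + \<beta> * (1 - \<alpha> * l)) /
          (2 * (1 - \<beta> * (1 - \<alpha> * l)) * (2 + 2 * \<beta> - \<alpha> * l * (1 + 2 * \<beta>))))"

end

theory Submission
  imports Defs
begin

text \<open>In an orthonormal eigenbasis of \<open>Q\<close> the iteration splits into scalar second-order
  autoregressions driven by uncorrelated noise of variance \<open>\<sigma>\<^sup>2\<close>, whose characteristic roots
  are eigenvalues of \<open>A\<^sub>Q\<close> and hence lie in the open unit disc. The second moments of each mode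
  satisfy a stable linear recurrence and so converge to its fixed point; weighting the limits by the
  eigenvalues gives the sum of the \<open>u\<^sub>\<alpha>\<^sub>,\<^sub>\<beta>(\<lambda>\<^sub>i)\<close>.\<close>

text \<open>Two features of the definitions shape the proof. \<open>spectral_radius\<close> is a
  \<open>Max\<close>, which bounds its elements only when the set is finite, so the block matrix
  must be shown to have finitely many eigenvalues before stability controls a single root. The list
  \<open>lam\<close> is known only through the characteristic polynomial, while the modes are
  indexed by an eigenbasis; comparing root multisets matches the two sums, repeated eigenvalues
  included.

  For an eigenvalue \<lambda> put q = 1 - \<alpha>\<lambda>, s = (1 + \<beta>)q and p = \<beta>q.
  The mode has characteristic polynomial z^2 - sz + p, and its limiting variance has denominator (1
  - p)(1 - s + p)(1 + s + p). Here 1 - s + p = \<alpha>\<lambda> cancels the weight \<lambda> and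
  one factor \<alpha>, and 1 + s + p = 2 + 2\<beta> - \<alpha>\<lambda>(1 + 2\<beta>); this is the
  origin of \<open>u_AG\<close>. Mixed moments of different modes never enter, because the objective
  is diagonal in the eigenbasis.\<close>

section \<open>Orthonormal eigenbases of symmetric matrices\<close>

text \<open>A first-order term cannot be dominated by a second-order one as t tends to 0. This is
  the variational step for the Rayleigh quotient, with \<open>n\<close> the squared length of a
  residual.\<close>

lemma quadratic_ray_bound_zero:
  fixes n K :: real
  assumes "\<And>t. 0 < t \<Longrightarrow> 2 * t * n \<le> t\<^sup>2 * K" and "0 \<le> n"
  shows "n = 0"
proof (rule ccontr)
  assume "n \<noteq> 0"
  with assms(2) have n: "n > 0" by simp
  \<comment> \<open>Small enough that \<open>t * K\<close> is at most \<open>n\<close>, which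
    contradicts \<open>2 * n \<le> t * K\<close>; the summand 1 keeps the denominator
    positive.\<close>
  define t where "t = n / (\<bar>K\<bar> + 1)"
  have t: "t > 0" using n by (simp add: t_def)
  have "2 * t * n \<le> t * (t * K)" using assms(1)[OF t] by (simp add: power2_eq_square mult_ac)
  then have "2 * n \<le> t * K" using t by (simp add: mult_ac)
  also have "t * K \<le> t * (\<bar>K\<bar> + 1)" using t by (intro mult_left_mono) auto
  also have "\<dots> = n" by (simp add: t_def)
  finally show False using n by simp
qed

text \<open>A maximiser of the Rayleigh quotient on the unit sphere of \<open>S\<close> is an eigenvector.\<close>

lemma self_adjoint_invariant_subspace_eigenvector:
  fixes T :: "'b::euclidean_space \<Rightarrow> 'b"
  assumes T: "linear T" and adj: "\<And>x y. T x \<bullet> y = x \<bullet> T y"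
    and S: "subspace S" "T ` S \<subseteq> S" and x0: "x0 \<in> S" "x0 \<noteq> 0"
  obtains v c where "v \<in> S" "norm v = 1" "T v = c *\<^sub>R v"
proof -
  interpret T: linear T by fact
  have comp: "compact (sphere 0 1 \<inter> S)"
    by (intro compact_Int_closed closed_subspace S) auto
  have "x0 /\<^sub>R norm x0 \<in> sphere 0 1 \<inter> S"
    using x0 S by (simp add: subspace_scale)
  then have ne: "sphere 0 1 \<inter> S \<noteq> {}" by blast
  have cont: "continuous_on (sphere 0 1 \<inter> S) (\<lambda>x. x \<bullet> T x)"
    by (intro continuous_intros linear_continuous_on_compose[OF _ T])
  obtain v where v: "v \<in> sphere 0 1 \<inter> S"
    and max: "\<And>u. u \<in> sphere 0 1 \<inter> S \<Longrightarrow> u \<bullet> T u \<le> v \<bullet> T v"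
    using continuous_attains_sup[OF comp ne cont] by blast
  define c where "c = v \<bullet> T v"
  have vv: "v \<bullet> v = 1" using v by (simp add: dot_square_norm)
  have bound: "u \<bullet> T u \<le> c * (u \<bullet> u)" if "u \<in> S" for u
  proof (cases "u = 0")
    case False
    have "(u /\<^sub>R norm u) \<bullet> T (u /\<^sub>R norm u) \<le> c"
      unfolding c_def using that False S by (intro max) (simp add: subspace_scale)
    then show ?thesis using False
      by (simp add: T.scale dot_square_norm field_simps power2_eq_square)
  qed (simp add: T.zero)
  \<comment> \<open>The residual \<open>h\<close> lies in \<open>S\<close> and is orthogonal to
    \<open>v\<close>, so \<open>v + t *\<^sub>R h\<close> is an admissible perturbation; the
    Rayleigh quotient would grow along it at first order unless \<open>h\<close> vanishes.\<close>
  define h where "h = T v - c *\<^sub>R v"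
  have hS: "h \<in> S" unfolding h_def using v S by (auto intro!: subspace_diff subspace_scale)
  have hv: "h \<bullet> v = 0"
    by (simp add: h_def inner_diff_left vv c_def adj)
  have hT: "h \<bullet> T v = h \<bullet> h"
  proof -
    have "T v = h + c *\<^sub>R v" by (simp add: h_def)
    then show ?thesis using hv by (simp add: inner_add_right)
  qed
  have "2 * t * (h \<bullet> h) \<le> t\<^sup>2 * (c * (h \<bullet> h) - h \<bullet> T h)" for t
  proof -
    have "(v + t *\<^sub>R h) \<bullet> T (v + t *\<^sub>R h) \<le> c * ((v + t *\<^sub>R h) \<bullet> (v + t *\<^sub>R h))"
      using v hS S by (intro bound) (auto intro!: subspace_add subspace_scale)
    moreover have "v \<bullet> T h = h \<bullet> h"
      using adj[of v h] hT by (simp add: inner_commute)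
    ultimately show ?thesis
      using hv by (simp add: T.add T.scale inner_add_left inner_add_right hT c_def[symmetric] vv
          algebra_simps power2_eq_square inner_commute)
  qed
  then have "h \<bullet> h = 0" by (intro quadratic_ray_bound_zero) auto
  then have "T v = c *\<^sub>R v" by (simp add: h_def)
  then show thesis using that v by auto
qed

text \<open>An orthonormal set of eigenvectors of maximal size exists, since such sets are
  independent. Its orthogonal complement is invariant under \<open>T\<close>, so a nonzero
  complement would supply one more eigenvector.\<close>

lemma self_adjoint_orthonormal_eigenbasis:
  fixes T :: "'b::euclidean_space \<Rightarrow> 'b"
  assumes T: "linear T" and adj: "\<And>x y. T x \<bullet> y = x \<bullet> T y"
  obtains B where "pairwise orthogonal B" "\<And>b. b \<in> B \<Longrightarrow> norm b = 1"
    "\<And>b. b \<in> B \<Longrightarrow> \<exists>c. T b = c *\<^sub>R b" "card B = DIM('b)" "finite B"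
proof -
  define good where "good = (\<lambda>B. pairwise orthogonal B \<and> (\<forall>b\<in>B. norm b = 1 \<and> (\<exists>c. T b = c *\<^sub>R b)))"
  have indep: "independent B" if "good B" for B
    using that unfolding good_def by (intro pairwise_orthogonal_independent) auto
  have bnd: "finite B \<and> card B \<le> DIM('b)" if "good B" for B
    using independent_bound_general[OF indep[OF that]] by (auto intro: le_trans dim_subset_UNIV)
  have "good {}" by (simp add: good_def)
  then obtain B where B: "good B" and max: "\<And>C. good C \<Longrightarrow> card C \<le> card B"
    using ex_has_greatest_nat[of good "{}" card "Suc DIM('b)"] bnd by (metis less_Suc_eq_le)
  define S where "S = {x. \<forall>b\<in>B. orthogonal b x}"
  have S: "subspace S"
    unfolding S_def by (auto simp: subspace_def orthogonal_def inner_add_right)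
  have inv: "T ` S \<subseteq> S"
  proof clarify
    fix x assume x: "x \<in> S"
    show "T x \<in> S" unfolding S_def orthogonal_def
    proof clarify
      fix b assume b: "b \<in> B"
      then obtain c where "T b = c *\<^sub>R b" using B unfolding good_def by blast
      then show "b \<bullet> T x = 0" using x b adj[of b x] by (auto simp: S_def orthogonal_def)
    qed
  qed
  have "S \<subseteq> {0}"
  proof (rule ccontr)
    assume "\<not> S \<subseteq> {0}"
    then obtain x0 where "x0 \<in> S" "x0 \<noteq> 0" by auto
    then obtain v c where v: "v \<in> S" "norm v = 1" "T v = c *\<^sub>R v"
      using self_adjoint_invariant_subspace_eigenvector[OF T adj S inv] by blast
    have "v \<notin> B" using v by (auto simp: S_def orthogonal_def)
    moreover have "good (insert v B)"
      using B v unfolding good_def S_def by (auto simp: pairwise_insert orthogonal_commute)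
    ultimately show False using max[of "insert v B"] bnd[OF B] by auto
  qed
  have "span B = UNIV"
  proof (rule ccontr)
    assume "span B \<noteq> UNIV"
    then have "dim B < DIM('b)"
      by (metis dim_eq_full dim_subset_UNIV le_neq_implies_less)
    then obtain x where "x \<noteq> 0" "\<And>y. y \<in> span B \<Longrightarrow> orthogonal x y"
      using orthogonal_to_subspace_exists by (metis)
    then have "x \<in> S" by (auto simp: S_def span_base orthogonal_commute)
    with \<open>S \<subseteq> {0}\<close> \<open>x \<noteq> 0\<close> show False by auto
  qed
  then have "card B = DIM('b)" using dim_eq_card[of B UNIV] indep[OF B] by simp
  then show thesis using that B bnd[OF B] unfolding good_def by blast
qed

lemma symmetric_matrix_inner:
  fixes Q :: "real^'n^'n"
  assumes "transpose Q = Q"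
  shows "(Q *v a) \<bullet> b = a \<bullet> (Q *v b)"
  by (metis assms dot_lmul_matrix transpose_matrix_vector)

text \<open>The basis has as many elements as the index type, so it can be indexed by that type
  itself. The matrix with rows \<open>v i\<close> is then square, which the completeness and
  determinant arguments rely on.\<close>

lemma symmetric_matrix_eigenbasis:
  fixes Q :: "real^'n^'n"
  assumes "transpose Q = Q"
  obtains v :: "'n \<Rightarrow> real^'n" and d :: "'n \<Rightarrow> real"
  where "\<And>i j. v i \<bullet> v j = (if i = j then 1 else 0)" "\<And>i. Q *v v i = d i *\<^sub>R v i"
proof -
  obtain B where B: "pairwise orthogonal B" "\<And>b. b \<in> B \<Longrightarrow> norm b = 1"
    "\<And>b. b \<in> B \<Longrightarrow> \<exists>c. Q *v b = c *\<^sub>R b" "card B = CARD('n)" "finite B"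
    using self_adjoint_orthonormal_eigenbasis[OF matrix_vector_mul_linear[of Q]
        symmetric_matrix_inner[OF assms]] by auto
  then obtain v where v: "bij_betw v (UNIV :: 'n set) B"
    using finite_same_card_bij[of "UNIV :: 'n set" B] by auto
  then have vB: "v i \<in> B" for i by (auto simp: bij_betw_def)
  then have "\<forall>i. \<exists>c. Q *v v i = c *\<^sub>R v i" using B(3) by blast
  then obtain d where "\<And>i. Q *v v i = d i *\<^sub>R v i" by metis
  moreover have "v i \<bullet> v j = (if i = j then 1 else 0)" for i j
  proof (cases "i = j")
    case False
    then have "v i \<noteq> v j" using v by (auto simp: bij_betw_def inj_def)
    then show ?thesis using False vB B(1) by (simp add: pairwise_def orthogonal_def)
  qed (use vB B(2) in \<open>simp add: dot_square_norm\<close>)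
  ultimately show thesis using that by blast
qed

text \<open>Orthonormal rows of a square matrix force orthonormal columns, because a right inverse
  of a square matrix is also a left inverse.\<close>

lemma orthonormal_family_complete:
  fixes v :: "'n \<Rightarrow> real^'n"
  assumes "\<And>i j. v i \<bullet> v j = (if i = j then 1 else 0)"
  shows "(\<Sum>m\<in>UNIV. v m $ i * v m $ j) = (if i = j then 1 else 0)"
proof -
  define P :: "real^'n^'n" where "P = (\<chi> i j. v i $ j)"
  have "P ** transpose P = mat 1"
    using assms by (simp add: P_def matrix_matrix_mult_def transpose_def mat_def vec_eq_iff inner_vec_def)
  then have "transpose P ** P = mat 1" by (simp add: matrix_left_right_inverse)
  then show ?thesis
    by (simp add: P_def matrix_matrix_mult_def transpose_def mat_def vec_eq_iff)
qed

lemma orthonormal_family_expansion: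
  fixes v :: "'n \<Rightarrow> real^'n"
  assumes "\<And>i j. v i \<bullet> v j = (if i = j then 1 else 0)"
  shows "(\<Sum>m\<in>UNIV. (v m \<bullet> x) *\<^sub>R v m) = x"
proof -
  have "(\<Sum>m\<in>UNIV. (v m \<bullet> x) *\<^sub>R v m) $ i = (\<Sum>j\<in>UNIV. (\<Sum>m\<in>UNIV. v m $ i * v m $ j) * x $ j)" for i
    unfolding inner_vec_def sum_distrib_right
    by (subst sum.swap) (simp add: sum_distrib_left sum_distrib_right mult_ac)
  then show ?thesis
    unfolding orthonormal_family_complete[OF assms]
    by (simp add: vec_eq_iff if_distrib[where f="\<lambda>x. x * _"] cong: if_cong)
qed

text \<open>The eigenbasis conjugates \<open>mat z - Q\<close> to a diagonal matrix, and the
  determinant of the change of basis cancels because its square is 1.\<close>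

lemma det_eq_prod_eigenvalues:
  fixes Q :: "real^'n^'n" and v :: "'n \<Rightarrow> real^'n" and d :: "'n \<Rightarrow> real"
  assumes on: "\<And>i j. v i \<bullet> v j = (if i = j then 1 else 0 :: real)" and ev: "\<And>i. Q *v v i = d i *\<^sub>R v i"
  shows "det (mat z - Q) = (\<Prod>i\<in>UNIV. z - d i)"
proof -
  define P :: "real^'n^'n" where "P = (\<chi> i j. v i $ j)"
  define D :: "real^'n^'n" where "D = (\<chi> i j. if i = j then z - d i else 0)"
  have PP: "P ** transpose P = mat 1"
    using on by (simp add: P_def matrix_matrix_mult_def transpose_def mat_def vec_eq_iff inner_vec_def)
  have Qv: "(\<Sum>k\<in>UNIV. Q $ i $ k * v j $ k) = d j * v j $ i" for i j
    using ev[of j] by (simp add: vec_eq_iff matrix_vector_mult_def)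
  have "((mat z - Q) ** transpose P) $ i $ j = (transpose P ** D) $ i $ j" for i j
    by (simp add: P_def D_def matrix_matrix_mult_def transpose_def mat_def left_diff_distrib
        sum_subtractf Qv if_distrib[where f="\<lambda>x. x * _"] if_distrib[where f="\<lambda>x. _ * x"] cong: if_cong)
      (simp add: algebra_simps)
  then have eq: "(mat z - Q) ** transpose P = transpose P ** D" by (simp add: vec_eq_iff)
  have dP: "det P * det P = 1" using arg_cong[OF PP, of det] by (simp add: det_mul det_transpose)
  have "det (mat z - Q) * det P = det P * det D"
    using arg_cong[OF eq, of det] by (simp add: det_mul det_transpose)
  then have "det (mat z - Q) = det D" using dP
    by (simp add: mult.commute) (metis mult_cancel_left mult_zero_left zero_neq_one)
  also have "\<dots> = (\<Prod>i\<in>UNIV. z - d i)"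
    unfolding D_def by (subst det_diagonal) auto
  finally show ?thesis .
qed

text \<open>In characteristic zero, products that agree at every point agree as polynomials, hence
  have the same multiset of roots. No explicit bijection between the index sets is required.\<close>

lemma sum_cong_of_linear_factors:
  fixes a :: "'i \<Rightarrow> 'b::{idom,ring_char_0}"
  assumes "finite I" "finite J" "\<And>z. (\<Prod>i\<in>I. z - a i) = (\<Prod>j\<in>J. z - b j)"
  shows "(\<Sum>i\<in>I. g (a i)) = (\<Sum>j\<in>J. g (b j))"
proof -
  have roots: "proots (\<Prod>i\<in>K. [:- c i, 1:]) = image_mset c (mset_set K)"
    if "finite K" for K :: "'j set" and c :: "'j \<Rightarrow> 'b"
    using that
  proof (induction K)
    case (insert k K)
    then have "proots ([:- c k, 1:] * (\<Prod>i\<in>K. [:- c i, 1:]))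
        = proots [:- c k, 1:] + proots (\<Prod>i\<in>K. [:- c i, 1:])"
      by (intro proots_mult) (auto simp: prod_zero_iff)
    with insert show ?case by simp
  qed simp
  have "poly (\<Prod>i\<in>I. [:- a i, 1:]) = poly (\<Prod>j\<in>J. [:- b j, 1:])"
    using assms(3) by (simp add: fun_eq_iff poly_prod)
  then have "(\<Prod>i\<in>I. [:- a i, 1:]) = (\<Prod>j\<in>J. [:- b j, 1:])"
    by (simp add: poly_eq_poly_eq_iff)
  then have "image_mset a (mset_set I) = image_mset b (mset_set J)"
    using roots assms(1,2) by metis
  then have "image_mset g (image_mset a (mset_set I)) = image_mset g (image_mset b (mset_set J))"
    by simp
  then show ?thesis by (simp add: sum_unfold_sum_mset multiset.map_comp comp_def)
qed

section \<open>Eigenvalues of the iteration matrix\<close>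

lemma sum_UNIV_Plus:
  "(\<Sum>j\<in>(UNIV :: ('n::finite + 'm::finite) set). g j) = (\<Sum>j\<in>UNIV. g (Inl j)) + (\<Sum>j\<in>UNIV. g (Inr j))"
  using sum.Plus[of "UNIV :: 'n set" "UNIV :: 'm set" g] by simp

text \<open>\<open>G\<close> is the action of I - \<alpha>Q on complex vectors, written with
  explicit sums. The two conjuncts are the block rows of the eigenvector equation; they serve both
  to build eigenvectors and to take them apart.\<close>

lemma AG_matrix_complex_eigenvector_iff:
  fixes Q :: "real^'n^'n" and u :: "complex^('n + 'n)" and \<alpha> :: real
  defines "G \<equiv> \<lambda>h i. h i - complex_of_real \<alpha> * (\<Sum>j\<in>UNIV. complex_of_real (Q $ i $ j) * h j)"
  shows "(\<chi> i j. complex_of_real (AG_matrix \<alpha> \<beta> Q $ i $ j)) *v u = z *s u \<longleftrightarrow>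
    (\<forall>i. (1 + complex_of_real \<beta>) * G (\<lambda>j. u $ Inl j) i - complex_of_real \<beta> * G (\<lambda>j. u $ Inr j) i
       = z * u $ Inl i) \<and> (\<forall>i. u $ Inl i = z * u $ Inr i)"
proof -
  have delta: "(\<Sum>j\<in>UNIV. complex_of_real (if i = j then 1 else 0) * h j) = h i" for i :: 'n and h
    by (simp add: if_distrib[where f=complex_of_real] if_distrib[where f="\<lambda>x. x * _"] cong: if_cong)
  have G: "(\<Sum>j\<in>UNIV. complex_of_real (c * ((if i = j then 1 else 0) - \<alpha> * Q $ i $ j)) * h j)
      = complex_of_real c * G h i" for c i h
  proof -
    have "(\<Sum>j\<in>UNIV. complex_of_real (c * ((if i = j then 1 else 0) - \<alpha> * Q $ i $ j)) * h j)
      = complex_of_real c * ((\<Sum>j\<in>UNIV. complex_of_real (if i = j then 1 else 0) * h j)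
        - complex_of_real \<alpha> * (\<Sum>j\<in>UNIV. complex_of_real (Q $ i $ j) * h j))"
      unfolding sum_distrib_left sum_subtractf[symmetric]
      by (intro sum.cong refl) (simp add: algebra_simps)
    then show ?thesis unfolding delta G_def .
  qed
  have top: "(\<Sum>j\<in>UNIV. complex_of_real (AG_matrix \<alpha> \<beta> Q $ Inl i $ j) * u $ j)
    = (1 + complex_of_real \<beta>) * G (\<lambda>j. u $ Inl j) i - complex_of_real \<beta> * G (\<lambda>j. u $ Inr j) i" for i
    using G[of "1 + \<beta>" i "\<lambda>j. u $ Inl j"] G[of "- \<beta>" i "\<lambda>j. u $ Inr j"]
    by (simp add: sum_UNIV_Plus AG_matrix_def block_matrix_def mat_def)
  have bot: "(\<Sum>j\<in>UNIV. complex_of_real (AG_matrix \<alpha> \<beta> Q $ Inr i $ j) * u $ j) = u $ Inl i" for i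
    using delta[of i "\<lambda>j. u $ Inl j"]
    by (simp add: sum_UNIV_Plus AG_matrix_def block_matrix_def mat_def)
  have split: "(\<forall>i. P i) \<longleftrightarrow> (\<forall>i. P (Inl i)) \<and> (\<forall>i. P (Inr i))" for P :: "'n + 'n \<Rightarrow> bool"
    by (metis sum.exhaust)
  show ?thesis
    by (simp add: vec_eq_iff matrix_vector_mult_def split top bot)
qed

text \<open>The lower block row forces an eigenvector of the shape (z v, v). For an eigenvector
  \<open>v\<close> of \<open>Q\<close>, the upper row then collapses to the scalar quadratic for
  \<open>z\<close>.\<close>

lemma AG_matrix_complex_eigenvalue:
  fixes Q :: "real^'n^'n"
  assumes "v \<noteq> 0" "Q *v v = l *\<^sub>R v"
    and z: "z\<^sup>2 = complex_of_real ((1 + \<beta>) * (1 - \<alpha> * l)) * z - complex_of_real (\<beta> * (1 - \<alpha> * l))"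
  shows "complex_eigenvalue (AG_matrix \<alpha> \<beta> Q) z"
proof -
  define u :: "complex^('n + 'n)" where
    "u = (\<chi> i. case i of Inl a \<Rightarrow> z * complex_of_real (v $ a) | Inr a \<Rightarrow> complex_of_real (v $ a))"
  have "\<exists>i. v $ i \<noteq> 0" using assms(1) by (simp add: vec_eq_iff)
  then obtain i where "v $ i \<noteq> 0" ..
  then have "u $ Inr i \<noteq> 0" by (simp add: u_def)
  then have u0: "u \<noteq> 0" by (metis zero_index)
  have "(\<Sum>j\<in>UNIV. Q $ i $ j * v $ j) = l * v $ i" for i
    using assms(2) by (simp add: vec_eq_iff matrix_vector_mult_def)
  then have Qv: "(\<Sum>j\<in>UNIV. complex_of_real (Q $ i $ j) * complex_of_real (v $ j))
      = complex_of_real l * complex_of_real (v $ i)" for i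
    by (metis (mono_tags, lifting) of_real_mult of_real_sum sum.cong)
  have Qzv: "(\<Sum>j\<in>UNIV. complex_of_real (Q $ i $ j) * (z * complex_of_real (v $ j)))
      = z * (complex_of_real l * complex_of_real (v $ i))" for i
    unfolding Qv[symmetric] sum_distrib_left by (simp add: mult_ac)
  have zz: "z * (z * complex_of_real c) = (complex_of_real ((1 + \<beta>) * (1 - \<alpha> * l)) * z
      - complex_of_real (\<beta> * (1 - \<alpha> * l))) * complex_of_real c" for c
    using z by (simp add: power2_eq_square mult.assoc[symmetric])
  show ?thesis
    unfolding complex_eigenvalue_def AG_matrix_complex_eigenvector_iff
    by (intro exI[of _ u] conjI u0; simp add: u_def Qv Qzv zz) (simp add: algebra_simps)
qed

text \<open>Projecting an eigenvector onto the eigenbasis of \<open>Q\<close> shows that its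
  eigenvalue is a root of one of the finitely many monic quadratics \<open>p m\<close>.\<close>

lemma finite_complex_eigenvalues_AG_matrix:
  fixes Q :: "real^'n^'n" and v :: "'n \<Rightarrow> real^'n" and d :: "'n \<Rightarrow> real"
  assumes sym: "transpose Q = Q"
    and on: "\<And>i j. v i \<bullet> v j = (if i = j then 1 else 0 :: real)"
    and ev: "\<And>i. Q *v v i = d i *\<^sub>R v i"
  shows "finite {z. complex_eigenvalue (AG_matrix \<alpha> \<beta> Q) z}"
proof -
  define q where "q = (\<lambda>m. complex_of_real (1 - \<alpha> * d m))"
  define p where "p = (\<lambda>m. [:complex_of_real \<beta> * q m, - ((1 + complex_of_real \<beta>) * q m), 1:])"
  have "\<exists>m. poly (p m) z = 0" if "complex_eigenvalue (AG_matrix \<alpha> \<beta> Q) z" for z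
  proof -
    define G where "G = (\<lambda>h i. h i - complex_of_real \<alpha> * (\<Sum>j\<in>UNIV. complex_of_real (Q $ i $ j) * h j))"
    \<comment> \<open>The coordinate of a complex vector along the real vector \<open>v m\<close>.
      By symmetry \<open>Q\<close> moves over to \<open>v m\<close>, so \<open>G\<close> becomes
      multiplication by \<open>q m\<close>.\<close>
    define c where "c = (\<lambda>m h. \<Sum>i\<in>UNIV. complex_of_real (v m $ i) * h i)"
    from that obtain u where u: "u \<noteq> 0"
      and top: "\<And>i. (1 + complex_of_real \<beta>) * G (\<lambda>j. u $ Inl j) i
            - complex_of_real \<beta> * G (\<lambda>j. u $ Inr j) i = z * u $ Inl i"
      and bot: "\<And>i. u $ Inl i = z * u $ Inr i"
      unfolding complex_eigenvalue_def AG_matrix_complex_eigenvector_iff G_def by blast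
    have Qsym: "Q $ i $ j = Q $ j $ i" for i j
      using sym by (metis transpose_def vec_lambda_beta)
    have Qv: "(\<Sum>i\<in>UNIV. Q $ i $ j * v m $ i) = d m * v m $ j" for j m
    proof -
      have "(\<Sum>i\<in>UNIV. Q $ i $ j * v m $ i) = (Q *v v m) $ j"
        unfolding matrix_vector_mult_def vec_lambda_beta by (subst Qsym) (rule refl)
      then show ?thesis by (simp add: ev)
    qed
    have cG: "c m (G h) = q m * c m h" for m h
    proof -
      have "(\<Sum>i\<in>UNIV. \<Sum>j\<in>UNIV. complex_of_real (v m $ i) * (complex_of_real (Q $ i $ j) * h j))
          = (\<Sum>j\<in>UNIV. complex_of_real (\<Sum>i\<in>UNIV. Q $ i $ j * v m $ i) * h j)"
        by (subst sum.swap) (simp add: sum_distrib_left sum_distrib_right mult_ac)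
      also have "\<dots> = complex_of_real (d m) * c m h"
        unfolding Qv by (simp add: c_def sum_distrib_left mult_ac)
      finally have "(\<Sum>i\<in>UNIV. complex_of_real (v m $ i) *
          (\<Sum>j\<in>UNIV. complex_of_real (Q $ i $ j) * h j)) = complex_of_real (d m) * c m h"
        by (simp add: sum_distrib_left)
      moreover have "c m (G h) = c m h - complex_of_real \<alpha> * (\<Sum>i\<in>UNIV. complex_of_real (v m $ i) *
          (\<Sum>j\<in>UNIV. complex_of_real (Q $ i $ j) * h j))"
        by (simp add: c_def G_def right_diff_distrib sum_subtractf sum_distrib_left mult_ac)
      ultimately show ?thesis by (simp add: q_def algebra_simps)
    qed
    have ca: "c m (\<lambda>j. u $ Inl j) = z * c m (\<lambda>j. u $ Inr j)" for m
      by (simp add: c_def bot sum_distrib_left mult_ac)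
    have lin: "c m (\<lambda>i. a * g i - b * h i) = a * c m g - b * c m h"
      "c m (\<lambda>i. a * g i) = a * c m g" for m a b g h
      by (simp_all add: c_def sum_distrib_left right_diff_distrib sum_subtractf mult_ac)
    have "(1 + complex_of_real \<beta>) * c m (G (\<lambda>j. u $ Inl j)) - complex_of_real \<beta> * c m (G (\<lambda>j. u $ Inr j))
        = z * c m (\<lambda>j. u $ Inl j)" for m
      by (subst lin(1)[symmetric], subst lin(2)[symmetric]) (simp only: top)
    then have *: "poly (p m) z * c m (\<lambda>j. u $ Inr j) = 0" for m
      by (simp add: cG ca p_def algebra_simps)
    \<comment> \<open>If every coordinate of the lower half vanished, completeness would make that
      half zero, and the upper half too, being \<open>z\<close> times the lower.\<close>
    have "\<exists>m. c m (\<lambda>j. u $ Inr j) \<noteq> 0"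
    proof (rule ccontr)
      assume "\<not> ?thesis"
      then have c0: "\<And>m. c m (\<lambda>j. u $ Inr j) = 0" by simp
      have "u $ Inr i = 0" for i
      proof -
        have "0 = (\<Sum>m\<in>UNIV. complex_of_real (v m $ i) * c m (\<lambda>j. u $ Inr j))" using c0 by simp
        also have "\<dots> = (\<Sum>j\<in>UNIV. complex_of_real (\<Sum>m\<in>UNIV. v m $ i * v m $ j) * u $ Inr j)"
          unfolding c_def sum_distrib_left
          by (subst sum.swap) (simp add: sum_distrib_left sum_distrib_right mult_ac)
        also have "\<dots> = u $ Inr i"
          unfolding orthonormal_family_complete[OF on] by (simp add: if_distrib[where f=complex_of_real] if_distrib[where f="\<lambda>x. x * _"] cong: if_cong)
        finally show ?thesis by simp
      qed
      then have "u $ i = 0" for i using bot by (cases i) simp_all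
      then have "u = 0" by (simp add: vec_eq_iff)
      with u show False ..
    qed
    with * show ?thesis by (metis mult_eq_0_iff)
  qed
  then have "{z. complex_eigenvalue (AG_matrix \<alpha> \<beta> Q) z} \<subseteq> (\<Union>m. {z. poly (p m) z = 0})" by auto
  moreover have "finite (\<Union>m. {z. poly (p m) z = 0})"
    by (intro finite_UN_I poly_roots_finite) (auto simp: p_def)
  ultimately show ?thesis by (rule finite_subset)
qed

lemma stability_region_characteristic_root:
  fixes Q :: "real^'n^'n"
  assumes "(\<alpha>, \<beta>) \<in> stability_region Q" "transpose Q = Q" "v \<noteq> 0" "Q *v v = l *\<^sub>R v"
    and "z\<^sup>2 = complex_of_real ((1 + \<beta>) * (1 - \<alpha> * l)) * z - complex_of_real (\<beta> * (1 - \<alpha> * l))"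
  shows "norm z < 1"
proof -
  obtain b :: "'n \<Rightarrow> real^'n" and d where "\<And>i j. b i \<bullet> b j = (if i = j then 1 else 0)" "\<And>i. Q *v b i = d i *\<^sub>R b i"
    using symmetric_matrix_eigenbasis[OF assms(2)] by blast
  then have "finite (norm ` {z. complex_eigenvalue (AG_matrix \<alpha> \<beta> Q) z})"
    using finite_complex_eigenvalues_AG_matrix[OF assms(2)] by blast
  then have "norm z \<le> spectral_radius (AG_matrix \<alpha> \<beta> Q)"
    unfolding spectral_radius_def using AG_matrix_complex_eigenvalue[OF assms(3-5)]
    by (intro Max_ge) auto
  then show ?thesis using assms(1) by (simp add: stability_region_def)
qed

section \<open>Stable linear recurrences\<close>

text \<open>A contraction with vanishing input: late inputs contribute at most a small geometric
  series, and the state at time \<open>N\<close> is forgotten geometrically.\<close>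

lemma linear_recurrence_order1_tendsto_0:
  fixes t e :: "nat \<Rightarrow> 'b::real_normed_algebra"
  assumes rec: "\<And>k. t (Suc k) = c * t k + e k" and c: "norm c < 1" and e: "e \<longlonglongrightarrow> 0"
  shows "t \<longlonglongrightarrow> 0"
proof (rule LIMSEQ_I)
  fix \<epsilon> :: real assume "\<epsilon> > 0"
  define r where "r = norm c"
  have r: "0 \<le> r" "r < 1" using c by (simp_all add: r_def)
  have "(1 - r) * (\<epsilon> / 2) > 0" using r \<open>\<epsilon> > 0\<close> by simp
  \<comment> \<open>The threshold makes \<epsilon>/2 the fixed point of the bound
    \<open>b \<mapsto> r * b + (1 - r) * (\<epsilon> / 2)\<close>.\<close>
  then obtain N where N: "\<And>n. n \<ge> N \<Longrightarrow> norm (e n) < (1 - r) * (\<epsilon> / 2)"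
    using LIMSEQ_D[OF e] by (metis diff_zero)
  have bd: "norm (t (N + j)) \<le> r ^ j * norm (t N) + \<epsilon> / 2" for j
  proof (induction j)
    case (Suc j)
    have "norm (t (N + Suc j)) \<le> norm (c * t (N + j)) + norm (e (N + j))"
      using rec[of "N + j"] norm_triangle_ineq by simp
    also have "\<dots> \<le> r * norm (t (N + j)) + (1 - r) * (\<epsilon> / 2)"
      using N[of "N + j"] norm_mult_ineq[of c "t (N + j)"] by (simp add: r_def)
    also have "\<dots> \<le> r * (r ^ j * norm (t N) + \<epsilon> / 2) + (1 - r) * (\<epsilon> / 2)"
      using Suc r by (intro add_right_mono mult_left_mono)
    also have "\<dots> = r ^ Suc j * norm (t N) + \<epsilon> / 2" by (simp add: field_simps)
    finally show ?case .
  qed (use \<open>\<epsilon> > 0\<close> in simp)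
  have "(\<lambda>j. r ^ j * norm (t N)) \<longlonglongrightarrow> 0"
    using r by (auto intro!: tendsto_mult_left_zero LIMSEQ_power_zero)
  then obtain J where J: "\<And>j. j \<ge> J \<Longrightarrow> norm (r ^ j * norm (t N)) < \<epsilon> / 2"
    using LIMSEQ_D[of _ 0 "\<epsilon> / 2"] \<open>\<epsilon> > 0\<close> by (metis diff_zero half_gt_zero)
  show "\<exists>no. \<forall>n\<ge>no. norm (t n - 0) < \<epsilon>"
  proof (intro exI allI impI)
    fix n assume "n \<ge> N + J"
    then have "norm (t n) \<le> r ^ (n - N) * norm (t N) + \<epsilon> / 2" using bd[of "n - N"] by simp
    also have "r ^ (n - N) * norm (t N) < \<epsilon> / 2" using J[of "n - N"] \<open>n \<ge> N + J\<close>
      by (simp only: real_norm_def abs_less_iff)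
    finally show "norm (t n - 0) < \<epsilon>" by simp
  qed
qed

text \<open>With E the shift, the recurrence reads (E - x)(E - y)(E - z)d = 0, and the factors are
  removed one at a time by the first-order lemma. Coinciding roots therefore need no special
  case.\<close>

lemma linear_recurrence_order3_tendsto_0:
  fixes d :: "nat \<Rightarrow> 'b::real_normed_field"
  assumes "\<And>k. d (k + 3) = (x + y + z) * d (k + 2) - (x * y + y * z + x * z) * d (k + 1) + x * y * z * d k"
    and "norm x < 1" "norm y < 1" "norm z < 1"
  shows "d \<longlonglongrightarrow> 0"
proof -
  define t where "t = (\<lambda>k. d (Suc k) - x * d k)"
  define u where "u = (\<lambda>k. t (Suc k) - y * t k)"
  have "u (Suc k) = z * u k + 0" for k
    using assms(1)[of k] by (simp add: u_def t_def algebra_simps eval_nat_numeral)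
  then have "u \<longlonglongrightarrow> 0" using assms(4) by (rule linear_recurrence_order1_tendsto_0) simp
  then have "t \<longlonglongrightarrow> 0" using assms(3)
    by (intro linear_recurrence_order1_tendsto_0[where t = t and e = u]) (simp_all add: u_def)
  then show ?thesis using assms(2)
    by (intro linear_recurrence_order1_tendsto_0[where t = d and e = t]) (simp_all add: t_def)
qed

text \<open>Eliminating \<open>b\<close> leaves a recurrence of order three for \<open>a\<close> whose characteristic roots are the
  pairwise products \<open>z1\<^sup>2\<close>, \<open>z1 z2\<close>, \<open>z2\<^sup>2\<close> of the roots of \<open>z\<^sup>2 - s z + p\<close>.\<close>

lemma AR2_second_moment_tendsto:
  fixes a b :: "nat \<Rightarrow> real"
  assumes a: "\<And>k. a (k + 2) = s\<^sup>2 * a (k + 1) + p\<^sup>2 * a k - 2 * s * p * b k + c"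
    and b: "\<And>k. b (k + 1) = s * a (k + 1) - p * b k"
    and root: "\<And>z::complex. z\<^sup>2 = complex_of_real s * z - complex_of_real p \<Longrightarrow> norm z < 1"
  shows "1 - p \<noteq> 0" "1 - s + p \<noteq> 0" "1 + s + p \<noteq> 0"
    "a \<longlonglongrightarrow> c * (1 + p) / ((1 - p) * ((1 - s + p) * (1 + s + p)))"
proof -
  define z1 where "z1 = complex_of_real s / 2 + csqrt (complex_of_real (s\<^sup>2 / 4 - p))"
  define z2 where "z2 = complex_of_real s / 2 - csqrt (complex_of_real (s\<^sup>2 / 4 - p))"
  have sum: "z1 + z2 = complex_of_real s" by (simp add: z1_def z2_def)
  have prod: "z1 * z2 = complex_of_real p"
  proof -
    have "z1 * z2 = (complex_of_real s / 2)\<^sup>2 - (csqrt (complex_of_real (s\<^sup>2 / 4 - p)))\<^sup>2"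
      by (simp add: z1_def z2_def power2_eq_square algebra_simps)
    then show ?thesis by (simp only: power2_csqrt) (simp add: power2_eq_square)
  qed
  have n1: "norm z1 < 1"
    by (rule root) (simp add: sum[symmetric] prod[symmetric] power2_eq_square algebra_simps)
  have n2: "norm z2 < 1"
    by (rule root) (simp add: sum[symmetric] prod[symmetric] power2_eq_square algebra_simps)
  have n11: "norm (z1 * z1) < 1" and n12: "norm (z1 * z2) < 1" and n22: "norm (z2 * z2) < 1"
    using n1 n2 mult_left_le[of "norm z1" "norm z1"] mult_left_le[of "norm z2" "norm z1"]
      mult_left_le[of "norm z2" "norm z2"] by (simp_all add: norm_mult)
  have ne: "1 - z \<noteq> 0" "1 + z \<noteq> 0" if "norm z < 1" for z :: complex
    using that by (auto, metis add_eq_0_iff norm_minus_cancel norm_one less_irrefl)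
  \<comment> \<open>The three denominators are 1 - z1 z2, (1 - z1)(1 - z2) and (1 + z1)(1 + z2),
    nonzero because both roots lie in the open unit disc.\<close>
  show p1: "1 - p \<noteq> 0"
    using ne(1)[OF n12] unfolding prod by (metis of_real_0 of_real_1 of_real_diff)
  have "complex_of_real (1 - s + p) = (1 - z1) * (1 - z2)"
    by (simp add: sum[symmetric] prod[symmetric] algebra_simps)
  then show s1: "1 - s + p \<noteq> 0" using ne(1)[OF n1] ne(1)[OF n2] by (metis mult_eq_0_iff of_real_0)
  have "complex_of_real (1 + s + p) = (1 + z1) * (1 + z2)"
    by (simp add: sum[symmetric] prod[symmetric] algebra_simps)
  then show s2: "1 + s + p \<noteq> 0" using ne(2)[OF n1] ne(2)[OF n2] by (metis mult_eq_0_iff of_real_0)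
  \<comment> \<open>The constant solution of the order-three recurrence below; its denominator is
    the characteristic polynomial of that recurrence at 1.\<close>
  define l where "l = c * (1 + p) / ((1 - p) * ((1 - s + p) * (1 + s + p)))"
  have l: "l * ((1 - p) * ((1 - s + p) * (1 + s + p))) = c * (1 + p)"
    using p1 s1 s2 by (simp add: l_def)
  have a3: "a (k + 3) = (s\<^sup>2 - p) * a (k + 2) + (p\<^sup>2 - s\<^sup>2 * p) * a (k + 1) + p ^ 3 * a k + c * (1 + p)" for k
  proof -
    \<comment> \<open>The product \<open>2 * s * p * b k\<close> is read off from the equation for
      \<open>a\<close>, so the elimination divides by neither \<open>s\<close> nor
      \<open>p\<close>.\<close>
    have "- (2 * s * p * b (k + 1)) = - (2 * s\<^sup>2 * p) * a (k + 1)
        - p * (a (k + 2) - s\<^sup>2 * a (k + 1) - p\<^sup>2 * a k - c)"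
      unfolding a[of k] b[of k] by (simp add: algebra_simps power2_eq_square)
    then show ?thesis using a[of "k + 1"] by (simp add: algebra_simps power2_eq_square power3_eq_cube eval_nat_numeral)
  qed
  have d3: "a (k + 3) - l = (s\<^sup>2 - p) * (a (k + 2) - l) + (p\<^sup>2 - s\<^sup>2 * p) * (a (k + 1) - l) + p ^ 3 * (a k - l)" for k
    using l unfolding a3 by (simp add: algebra_simps power2_eq_square power3_eq_cube)
  have "(\<lambda>k. complex_of_real (a k - l)) \<longlonglongrightarrow> 0"
  proof (rule linear_recurrence_order3_tendsto_0[OF _ n11 n12 n22])
    fix k
    have c1: "z1 * z1 + z1 * z2 + z2 * z2 = complex_of_real (s\<^sup>2 - p)"
      by (simp add: sum[symmetric] prod[symmetric] power2_eq_square algebra_simps)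
    have c2: "z1 * z1 * (z1 * z2) + z1 * z2 * (z2 * z2) + z1 * z1 * (z2 * z2) = - complex_of_real (p\<^sup>2 - s\<^sup>2 * p)"
      by (simp add: sum[symmetric] prod[symmetric] power2_eq_square algebra_simps)
    have c3: "z1 * z1 * (z1 * z2) * (z2 * z2) = complex_of_real (p ^ 3)"
      by (simp add: prod[symmetric] power3_eq_cube algebra_simps)
    show "complex_of_real (a (k + 3) - l) = (z1 * z1 + z1 * z2 + z2 * z2) * complex_of_real (a (k + 2) - l)
      - (z1 * z1 * (z1 * z2) + z1 * z2 * (z2 * z2) + z1 * z1 * (z2 * z2)) * complex_of_real (a (k + 1) - l)
      + z1 * z1 * (z1 * z2) * (z2 * z2) * complex_of_real (a k - l)"
      unfolding c1 c2 c3 d3 by (simp add: algebra_simps)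
  qed
  then have "(\<lambda>k. a k - l) \<longlonglongrightarrow> 0" by (metis of_real_0 tendsto_of_real_iff)
  then show "a \<longlonglongrightarrow> c * (1 + p) / ((1 - p) * ((1 - s + p) * (1 + s + p)))"
    unfolding l_def[symmetric] by (simp add: LIM_zero_iff)
qed

section \<open>Second moments of autoregressions\<close>

text \<open>Composition with \<open>g\<close> and \<open>h\<close> turns two variables of different
  types into real ones, to which \<open>indep_var\<close> applies. Preimages form a pi-system, so
  independence extends to the generated sigma-algebras, and these contain those of the
  compositions.\<close>

lemma (in prob_space) independent_rvs_expectation_mult:
  fixes g :: "'b::topological_space \<Rightarrow> real" and h :: "'c \<Rightarrow> real"
  assumes ind: "independent_rvs M borel X T Y"
    and g: "g \<in> borel_measurable borel" and h: "h \<in> borel_measurable T"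
    and int: "integrable M (\<lambda>\<omega>. g (X \<omega>))" "integrable M (\<lambda>\<omega>. h (Y \<omega>))"
  shows "expectation (\<lambda>\<omega>. g (X \<omega>) * h (Y \<omega>)) = expectation (\<lambda>\<omega>. g (X \<omega>)) * expectation (\<lambda>\<omega>. h (Y \<omega>))"
proof -
  have X: "X \<in> measurable M borel" and Y: "Y \<in> measurable M T"
    and set: "indep_set {X -` A \<inter> space M | A. A \<in> sets borel} {Y -` B \<inter> space M | B. B \<in> sets T}"
    using ind by (auto simp: independent_rvs_def)
  have stable: "Int_stable {Z -` A \<inter> space M | A. A \<in> sets N}" for Z :: "'a \<Rightarrow> 'd" and N
  proof (rule Int_stableI)
    fix a b assume "a \<in> {Z -` A \<inter> space M | A. A \<in> sets N}" "b \<in> {Z -` A \<inter> space M | A. A \<in> sets N}"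
    then obtain A B where "a = Z -` A \<inter> space M" "b = Z -` B \<inter> space M" "A \<in> sets N" "B \<in> sets N" by blast
    then have "a \<inter> b = Z -` (A \<inter> B) \<inter> space M" "A \<inter> B \<in> sets N" by auto
    then show "a \<inter> b \<in> {Z -` A \<inter> space M | A. A \<in> sets N}" by blast
  qed
  have sub: "sigma_sets (space M) {(\<lambda>\<omega>. k (Z \<omega>)) -` A \<inter> space M | A. A \<in> sets borel}
      \<subseteq> sigma_sets (space M) {Z -` A \<inter> space M | A. A \<in> sets N}"
    if Z: "Z \<in> measurable M N" and k: "k \<in> borel_measurable N" for Z :: "'a \<Rightarrow> 'd" and N and k :: "'d \<Rightarrow> real"
  proof (rule sigma_sets_mono', clarify)
    fix A :: "real set" assume "A \<in> sets borel"
    then have "k -` A \<inter> space N \<in> sets N" using k by (intro measurable_sets)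
    moreover have "(\<lambda>\<omega>. k (Z \<omega>)) -` A \<inter> space M = Z -` (k -` A \<inter> space N) \<inter> space M"
      using measurable_space[OF Z] by auto
    ultimately show "\<exists>B. (\<lambda>\<omega>. k (Z \<omega>)) -` A \<inter> space M = Z -` B \<inter> space M \<and> B \<in> sets N" by blast
  qed
  have "indep_var borel (\<lambda>\<omega>. g (X \<omega>)) borel (\<lambda>\<omega>. h (Y \<omega>))"
    unfolding indep_var_eq
  proof (intro conjI)
    show "indep_set (sigma_sets (space M) {(\<lambda>\<omega>. g (X \<omega>)) -` A \<inter> space M |A. A \<in> sets borel})
       (sigma_sets (space M) {(\<lambda>\<omega>. h (Y \<omega>)) -` A \<inter> space M |A. A \<in> sets borel})"
      using indep_set_sigma_sets[OF set stable stable] sub[OF X g] sub[OF Y h]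
      unfolding indep_sets2_eq by blast
  qed (use X Y g h in measurable)
  then show ?thesis using int by (rule indep_var_lebesgue_integral)
qed

text \<open>Measurability is a separate conjunct because integrability of the square does not imply
  it.\<close>

definition square_integrable :: "'a measure \<Rightarrow> ('a \<Rightarrow> real) \<Rightarrow> bool" where
  "square_integrable M X \<longleftrightarrow> X \<in> borel_measurable M \<and> integrable M (\<lambda>\<omega>. (X \<omega>)\<^sup>2)"

lemma square_integrable_mult:
  assumes "square_integrable M X" "square_integrable M Y"
  shows "integrable M (\<lambda>\<omega>. X \<omega> * Y \<omega>)"
proof (rule Bochner_Integration.integrable_bound)
  show "integrable M (\<lambda>\<omega>. (X \<omega>)\<^sup>2 + (Y \<omega>)\<^sup>2)" "(\<lambda>\<omega>. X \<omega> * Y \<omega>) \<in> borel_measurable M"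
    using assms by (auto simp: square_integrable_def)
  show "AE \<omega> in M. norm (X \<omega> * Y \<omega>) \<le> norm ((X \<omega>)\<^sup>2 + (Y \<omega>)\<^sup>2)"
  proof (intro AE_I2)
    fix \<omega>
    have "2 * (\<bar>X \<omega>\<bar> * \<bar>Y \<omega>\<bar>) \<le> (X \<omega>)\<^sup>2 + (Y \<omega>)\<^sup>2"
      using sum_squares_bound[of "\<bar>X \<omega>\<bar>" "\<bar>Y \<omega>\<bar>"] by (simp add: mult_ac)
    moreover have "0 \<le> \<bar>X \<omega>\<bar> * \<bar>Y \<omega>\<bar>" by simp
    ultimately show "norm (X \<omega> * Y \<omega>) \<le> norm ((X \<omega>)\<^sup>2 + (Y \<omega>)\<^sup>2)"
      using abs_ge_self[of "(X \<omega>)\<^sup>2 + (Y \<omega>)\<^sup>2"] unfolding real_norm_def abs_mult by linarith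
  qed
qed

lemma square_integrable_add:
  assumes "square_integrable M X" "square_integrable M Y"
  shows "square_integrable M (\<lambda>\<omega>. X \<omega> + Y \<omega>)"
  using assms square_integrable_mult[OF assms]
  by (auto simp: square_integrable_def power2_sum mult.assoc)

lemma square_integrable_cmult:
  "square_integrable M X \<Longrightarrow> square_integrable M (\<lambda>\<omega>. c * X \<omega>)"
  by (auto simp: square_integrable_def power_mult_distrib)

lemma square_integrable_cong:
  "(\<And>\<omega>. \<omega> \<in> space M \<Longrightarrow> X \<omega> = Y \<omega>) \<Longrightarrow> square_integrable M X \<longleftrightarrow> square_integrable M Y"
  unfolding square_integrable_def
  by (intro conj_cong measurable_cong Bochner_Integration.integrable_cong) auto

lemma (in prob_space) square_integrable_const: "square_integrable M (\<lambda>_. c)"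
  by (simp add: square_integrable_def)

lemma (in prob_space) square_integrable_imp_integrable:
  assumes "square_integrable M X" shows "integrable M X"
  using square_integrable_mult[OF assms square_integrable_const[of 1]] by simp

lemma (in prob_space) AR2_square_integrable:
  fixes X :: "nat \<Rightarrow> 'a \<Rightarrow> real"
  assumes rec: "\<And>k \<omega>. \<omega> \<in> space M \<Longrightarrow> X (k + 2) \<omega> = s * X (k + 1) \<omega> - p * X k \<omega> - \<alpha> * \<eta> k \<omega>"
    and init: "square_integrable M (X 0)" "square_integrable M (X 1)"
    and \<eta>: "\<And>k. square_integrable M (\<eta> k)"
  shows "square_integrable M (X k)"
proof -
  have "square_integrable M (X k) \<and> square_integrable M (X (k + 1))"
  proof (induction k)
    case (Suc k)
    have "square_integrable M (\<lambda>\<omega>. (s * X (k + 1) \<omega> + (- p) * X k \<omega>) + (- \<alpha>) * \<eta> k \<omega>)"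
      using Suc \<eta> by (intro square_integrable_add square_integrable_cmult) auto
    then have "square_integrable M (X (k + 2))"
      using rec by (subst square_integrable_cong) (auto simp: algebra_simps)
    then show ?case using Suc by simp
  qed (use init in simp)
  then show ?thesis ..
qed

text \<open>Squaring the recurrence and multiplying it by \<open>X (k + 1)\<close> gives a closed
  system for the variance and the lag-one moment. The noise enters only through its variance and its
  vanishing correlation with the two preceding states.\<close>

lemma (in prob_space) AR2_expectation_square_tendsto:
  fixes X :: "nat \<Rightarrow> 'a \<Rightarrow> real"
  assumes rec: "\<And>k \<omega>. \<omega> \<in> space M \<Longrightarrow> X (k + 2) \<omega> = s * X (k + 1) \<omega> - p * X k \<omega> - \<alpha> * \<eta> k \<omega>"
    and X: "\<And>k. square_integrable M (X k)"
    and \<eta>: "\<And>k. square_integrable M (\<eta> k)" "\<And>k. expectation (\<lambda>\<omega>. (\<eta> k \<omega>)\<^sup>2) = v"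
    and uncorr: "\<And>k. expectation (\<lambda>\<omega>. \<eta> k \<omega> * X k \<omega>) = 0"
      "\<And>k. expectation (\<lambda>\<omega>. \<eta> k \<omega> * X (k + 1) \<omega>) = 0"
    and root: "\<And>z::complex. z\<^sup>2 = complex_of_real s * z - complex_of_real p \<Longrightarrow> norm z < 1"
  shows "1 - p \<noteq> 0" "1 - s + p \<noteq> 0" "1 + s + p \<noteq> 0"
    "(\<lambda>k. expectation (\<lambda>\<omega>. (X k \<omega>)\<^sup>2))
       \<longlonglongrightarrow> \<alpha>\<^sup>2 * v * (1 + p) / ((1 - p) * ((1 - s + p) * (1 + s + p)))"
proof -
  define a where "a = (\<lambda>k. expectation (\<lambda>\<omega>. (X k \<omega>)\<^sup>2))"
  define b where "b = (\<lambda>k. expectation (\<lambda>\<omega>. X (k + 1) \<omega> * X k \<omega>))"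
  have int: "integrable M (\<lambda>\<omega>. (X k \<omega>)\<^sup>2)" "integrable M (\<lambda>\<omega>. (\<eta> k \<omega>)\<^sup>2)"
    "integrable M (\<lambda>\<omega>. X j \<omega> * X k \<omega>)" "integrable M (\<lambda>\<omega>. \<eta> j \<omega> * X k \<omega>)" for j k
    using X \<eta>(1) square_integrable_mult[OF X X] square_integrable_mult[OF \<eta>(1) X]
    by (auto simp: square_integrable_def)
  have arec: "a (k + 2) = s\<^sup>2 * a (k + 1) + p\<^sup>2 * a k - 2 * s * p * b k + \<alpha>\<^sup>2 * v" for k
  proof -
    have "a (k + 2) = expectation (\<lambda>\<omega>. s\<^sup>2 * (X (k + 1) \<omega>)\<^sup>2 + p\<^sup>2 * (X k \<omega>)\<^sup>2
        - 2 * s * p * (X (k + 1) \<omega> * X k \<omega>) + \<alpha>\<^sup>2 * (\<eta> k \<omega>)\<^sup>2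
        - 2 * s * \<alpha> * (\<eta> k \<omega> * X (k + 1) \<omega>) + 2 * p * \<alpha> * (\<eta> k \<omega> * X k \<omega>))"
      unfolding a_def
      by (intro Bochner_Integration.integral_cong refl) (simp only: rec power2_eq_square, simp add: algebra_simps)
    also have "\<dots> = s\<^sup>2 * a (k + 1) + p\<^sup>2 * a k - 2 * s * p * b k + \<alpha>\<^sup>2 * v"
      using uncorr[of k] \<eta>(2)[of k] by (simp add: int a_def b_def)
    finally show ?thesis .
  qed
  have brec: "b (k + 1) = s * a (k + 1) - p * b k" for k
  proof -
    have "b (k + 1) = expectation (\<lambda>\<omega>. s * (X (k + 1) \<omega>)\<^sup>2 - p * (X (k + 1) \<omega> * X k \<omega>)
        - \<alpha> * (\<eta> k \<omega> * X (k + 1) \<omega>))"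
      unfolding b_def
    proof (intro Bochner_Integration.integral_cong refl)
      fix \<omega> assume "\<omega> \<in> space M"
      then have "X (k + 1 + 1) \<omega> = s * X (k + 1) \<omega> - p * X k \<omega> - \<alpha> * \<eta> k \<omega>"
        using rec[of \<omega> k] by (simp add: add.assoc)
      then show "X (k + 1 + 1) \<omega> * X (k + 1) \<omega> = s * (X (k + 1) \<omega>)\<^sup>2 - p * (X (k + 1) \<omega> * X k \<omega>)
        - \<alpha> * (\<eta> k \<omega> * X (k + 1) \<omega>)"
        by (simp only: power2_eq_square left_diff_distrib right_diff_distrib mult_ac)
    qed
    also have "\<dots> = s * a (k + 1) - p * b k"
      using uncorr[of k] by (simp add: int a_def b_def)
    finally show ?thesis .
  qed
  show "1 - p \<noteq> 0" "1 - s + p \<noteq> 0" "1 + s + p \<noteq> 0"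
    using AR2_second_moment_tendsto[OF arec brec root] by blast+
  show "(\<lambda>k. expectation (\<lambda>\<omega>. (X k \<omega>)\<^sup>2))
       \<longlonglongrightarrow> \<alpha>\<^sup>2 * v * (1 + p) / ((1 - p) * ((1 - s + p) * (1 + s + p)))"
    using AR2_second_moment_tendsto(4)[OF arec brec root] unfolding a_def .
qed

text \<open>The square of \<open>v \<bullet> w\<close> is the bounded linear functional
  \<open>A \<mapsto> v \<bullet> (A *v v)\<close> applied to the matrix w w^T, so it inherits
  integrability and expectation from that matrix.\<close>

lemma (in prob_space) isotropic_second_moment_inner:
  fixes w :: "'a \<Rightarrow> real^'n"
  assumes w: "w \<in> borel_measurable M" and "c \<noteq> 0"
    and cov: "expectation (\<lambda>\<omega>. (\<chi> i j. w \<omega> $ i * w \<omega> $ j) :: real^'n^'n) = mat c"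
  shows "square_integrable M (\<lambda>\<omega>. v \<bullet> w \<omega>)" "expectation (\<lambda>\<omega>. (v \<bullet> w \<omega>)\<^sup>2) = c * (v \<bullet> v)"
proof -
  define W where "W = (\<lambda>\<omega>. (\<chi> i j. w \<omega> $ i * w \<omega> $ j) :: real^'n^'n)"
  have matv: "mat c *v v = c *\<^sub>R v"
    by (simp add: matrix_vector_mult_def mat_def vec_eq_iff if_distrib[where f="\<lambda>x. x * _"] cong: if_cong)
  have "(mat c :: real^'n^'n) \<noteq> 0"
  proof
    assume "(mat c :: real^'n^'n) = 0"
    then have "(mat c :: real^'n^'n) $ undefined $ undefined = 0" by simp
    then show False using \<open>c \<noteq> 0\<close> by (simp add: mat_def)
  qed
  \<comment> \<open>The integral of a non-integrable function is 0 by convention; a nonzero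
    covariance therefore certifies integrability.\<close>
  then have "expectation W \<noteq> 0" using cov by (simp only: W_def not_False_eq_True)
  then have int: "integrable M W" by (rule contrapos_np) (rule not_integrable_integral_eq)
  have lin: "bounded_linear (\<lambda>A :: real^'n^'n. v \<bullet> (A *v v))"
    unfolding linear_conv_bounded_linear[symmetric]
    by (rule linearI) (simp_all add: matrix_vector_mult_add_rdistrib inner_add_right
        scaleR_matrix_vector_assoc[symmetric])
  have eq: "v \<bullet> (W \<omega> *v v) = (v \<bullet> w \<omega>)\<^sup>2" for \<omega>
    by (simp add: W_def inner_vec_def matrix_vector_mult_def power2_eq_square sum_product
        sum_distrib_left mult_ac)
  have "integrable M (\<lambda>\<omega>. (v \<bullet> w \<omega>)\<^sup>2)"
    using integrable_bounded_linear[OF lin int] unfolding eq .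
  then show "square_integrable M (\<lambda>\<omega>. v \<bullet> w \<omega>)" using w by (simp add: square_integrable_def)
  have "expectation (\<lambda>\<omega>. v \<bullet> (W \<omega> *v v)) = v \<bullet> (expectation W *v v)"
    by (rule integral_bounded_linear[OF lin int])
  also have "expectation W = mat c" using cov by (simp only: W_def)
  finally show "expectation (\<lambda>\<omega>. (v \<bullet> w \<omega>)\<^sup>2) = c * (v \<bullet> v)" by (simp add: eq matv)
qed

section \<open>Quadratic objectives and the noisy iteration\<close>

text \<open>Definiteness makes the kernel trivial, hence \<open>Q\<close> invertible. The solution
  is the minimiser of the objective, about which the iteration is recentred.\<close>

lemma sym_pos_def_solution:
  fixes Q :: "real^'n^'n"
  assumes "sym_pos_def Q"
  obtains xs where "Q *v xs = p"
proof -
  have "x = 0" if "Q *v x = 0" for x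
    using assms that by (metis inner_zero_right less_irrefl sym_pos_def_def)
  then obtain B where "B ** Q = mat 1" using matrix_left_invertible_ker[of Q] by blast
  then have "Q ** B = mat 1" by (simp add: matrix_left_right_inverse)
  then have "Q *v (B *v p) = p" by (simp add: matrix_vector_mul_assoc)
  then show thesis by (rule that)
qed

text \<open>Since \<open>gradient\<close> is a definite description, uniqueness of the derivative is
  proved along with its value. Symmetry of \<open>Q\<close> merges the two terms of the product
  rule.\<close>

lemma gradient_quadratic:
  fixes Q :: "real^'n^'n"
  assumes "transpose Q = Q"
  shows "gradient (\<lambda>z. 1 / 2 * (z \<bullet> (Q *v z)) - p \<bullet> z + r) x = Q *v x - p"
proof -
  have lin: "((\<lambda>z. Q *v z) has_derivative (\<lambda>h. Q *v h)) (at x)"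
    by (rule bounded_linear_imp_has_derivative) (rule matrix_vector_mul_bounded_linear)
  have "x \<bullet> (Q *v h) = h \<bullet> (Q *v x)" for h
    using symmetric_matrix_inner[OF assms, of x h] by (simp only: inner_commute)
  then have eq: "(\<lambda>h. 1 / 2 * (x \<bullet> (Q *v h) + h \<bullet> (Q *v x)) - p \<bullet> h + 0) = (\<lambda>h. h \<bullet> (Q *v x - p))"
    by (simp add: fun_eq_iff inner_diff_right inner_commute[of p])
  have der: "GDERIV (\<lambda>z. 1 / 2 * (z \<bullet> (Q *v z)) - p \<bullet> z + r) x :> Q *v x - p"
    unfolding gderiv_def eq[symmetric]
    by (intro has_derivative_add has_derivative_diff has_derivative_mult_right has_derivative_inner
        has_derivative_inner_right has_derivative_ident has_derivative_const lin)
  show ?thesis unfolding gradient_def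
  proof (rule the_equality, rule der)
    fix D assume "GDERIV (\<lambda>z. 1 / 2 * (z \<bullet> (Q *v z)) - p \<bullet> z + r) x :> D"
    then have "(\<lambda>h. h \<bullet> D) = (\<lambda>h. h \<bullet> (Q *v x - p))"
      using der unfolding gderiv_def by (rule has_derivative_unique)
    then show "D = Q *v x - p" using vector_eq_ldot[of D "Q *v x - p"] by (simp only: fun_eq_iff)
  qed
qed

lemma quadratic_diff_eq:
  fixes Q :: "real^'n^'n"
  assumes "transpose Q = Q" "Q *v xs = p"
    and f: "f = (\<lambda>z. 1 / 2 * (z \<bullet> (Q *v z)) - p \<bullet> z + r)"
  shows "f z - f xs = 1 / 2 * ((z - xs) \<bullet> (Q *v (z - xs)))"
proof -
  have "xs \<bullet> (Q *v z) = p \<bullet> z" using symmetric_matrix_inner[OF assms(1), of xs z] assms(2) by simp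
  then show ?thesis
    by (simp add: f matrix_vector_mult_diff_distrib assms(2) inner_diff_left inner_diff_right
        inner_commute algebra_simps)
qed

lemma min_value_quadratic:
  fixes Q :: "real^'n^'n"
  assumes "sym_pos_def Q" "Q *v xs = p"
    and f: "f = (\<lambda>z. 1 / 2 * (z \<bullet> (Q *v z)) - p \<bullet> z + r)"
  shows "min_value f = f xs"
  unfolding min_value_def
proof (rule Least_equality)
  fix m assume "m \<in> range f"
  then obtain z where z: "m = f z" by blast
  have "0 \<le> (z - xs) \<bullet> (Q *v (z - xs))"
    using assms(1) by (cases "z - xs = 0") (auto simp: sym_pos_def_def less_imp_le)
  then show "f xs \<le> m"
    using quadratic_diff_eq[OF _ assms(2) f, of z] assms(1) by (simp add: z sym_pos_def_def)
qed simp

lemma quadratic_form_eigenbasis: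
  fixes Q :: "real^'n^'n" and v :: "'n \<Rightarrow> real^'n"
  assumes "transpose Q = Q" and on: "\<And>i j. v i \<bullet> v j = (if i = j then 1 else 0)"
    and ev: "\<And>i. Q *v v i = d i *\<^sub>R v i"
  shows "x \<bullet> (Q *v x) = (\<Sum>i\<in>UNIV. d i * (v i \<bullet> x)\<^sup>2)"
proof -
  have "v i \<bullet> (Q *v x) = d i * (v i \<bullet> x)" for i
    using symmetric_matrix_inner[OF assms(1), of "v i" x] ev by simp
  moreover have "x \<bullet> (Q *v x) = (\<Sum>i\<in>UNIV. (v i \<bullet> x) *\<^sub>R v i) \<bullet> (Q *v x)"
    by (simp only: orthonormal_family_expansion[OF on])
  ultimately show ?thesis
    by (simp add: inner_sum_left power2_eq_square mult_ac)
qed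

text \<open>Both \<open>x k\<close> and \<open>x (k - 1)\<close> are components of entry
  \<open>k\<close> of the recorded history, so independence factors the expectation and the noise
  mean is zero.\<close>

lemma (in prob_space) noise_uncorrelated_with_iterates:
  fixes w y :: "nat \<Rightarrow> 'a \<Rightarrow> real^'n"
  assumes noise: "noise_assumption M \<sigma> w x y"
    and sq: "\<And>k. square_integrable M (\<lambda>\<omega>. v \<bullet> w k \<omega>)"
      "\<And>i. i \<ge> - 1 \<Longrightarrow> square_integrable M (\<lambda>\<omega>. v \<bullet> (x i \<omega> - xs))"
    and i: "i = int k \<or> i = int k - 1"
  shows "expectation (\<lambda>\<omega>. (v \<bullet> w k \<omega>) * (v \<bullet> (x i \<omega> - xs))) = 0"
proof -
  have wk: "integrable M (w k)" "expectation (w k) = 0"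
    and ind: "independent_rvs M borel (w k)
            (\<Pi>\<^sub>M i\<in>{1..k}. borel :: (((real^'n) \<times> (real^'n)) \<times> (real^'n)) measure)
            (\<lambda>\<omega>. \<lambda>i\<in>{1..k}. ((x (int i) \<omega>, x (int i - 1) \<omega>), y i \<omega>))"
    and const: "\<exists>c. \<forall>\<omega>\<in>space M. x 0 \<omega> = c" "\<exists>c. \<forall>\<omega>\<in>space M. x (- 1) \<omega> = c"
    using noise by (simp_all add: noise_assumption_def)
  have mean: "expectation (\<lambda>\<omega>. v \<bullet> w k \<omega>) = 0"
    using wk by simp
  show ?thesis
  proof (cases "k = 0")
    \<comment> \<open>The history over \<open>{1..0}\<close> is empty and carries no information on
      \<open>x 0\<close> and \<open>x (- 1)\<close>; here their being deterministic is what
      counts.\<close>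
    case True
    then obtain c where c: "\<And>\<omega>. \<omega> \<in> space M \<Longrightarrow> x i \<omega> = c"
      using const i by auto
    have "expectation (\<lambda>\<omega>. (v \<bullet> w k \<omega>) * (v \<bullet> (x i \<omega> - xs))) = expectation (\<lambda>\<omega>. (v \<bullet> w k \<omega>) * (v \<bullet> (c - xs)))"
      using c by (intro Bochner_Integration.integral_cong refl) simp
    also have "\<dots> = 0" using mean by simp
    finally show ?thesis .
  next
    case False
    define \<pi> :: "((real^'n) \<times> (real^'n)) \<times> (real^'n) \<Rightarrow> real^'n"
      where "\<pi> = (if i = int k then fst \<circ> fst else snd \<circ> fst)"
    have \<pi>: "(\<lambda>u. v \<bullet> (\<pi> u - xs)) \<in> borel_measurable borel"
      unfolding \<pi>_def by (intro borel_measurable_continuous_onI) (auto intro!: continuous_intros simp: comp_def)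
    have h: "(\<lambda>u. v \<bullet> (\<pi> (u k) - xs)) \<in> borel_measurable (\<Pi>\<^sub>M i\<in>{1..k}. borel)"
      using False by (intro measurable_compose[OF measurable_component_singleton[where i = k] \<pi>]) simp
    have hx: "v \<bullet> (\<pi> ((\<lambda>i\<in>{1..k}. ((x (int i) \<omega>, x (int i - 1) \<omega>), y i \<omega>)) k) - xs) = v \<bullet> (x i \<omega> - xs)" for \<omega>
      using False i by (auto simp: \<pi>_def)
    have "i \<ge> - 1" using i by auto
    then have int: "integrable M (\<lambda>\<omega>. v \<bullet> w k \<omega>)" "integrable M (\<lambda>\<omega>. v \<bullet> (x i \<omega> - xs))"
      using sq by (simp_all add: square_integrable_imp_integrable)
    have "expectation (\<lambda>\<omega>. (v \<bullet> w k \<omega>) * (v \<bullet> (x i \<omega> - xs)))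
        = expectation (\<lambda>\<omega>. v \<bullet> w k \<omega>) * expectation (\<lambda>\<omega>. v \<bullet> (x i \<omega> - xs))"
      using independent_rvs_expectation_mult[OF ind _ h, of "\<lambda>u. v \<bullet> u", unfolded hx] int by simp
    then show ?thesis using mean by simp
  qed
qed

lemma (in prob_space) AG_mode_second_moment:
  fixes Q :: "real^'n^'n" and w y :: "nat \<Rightarrow> 'a \<Rightarrow> real^'n"
  assumes f: "f = (\<lambda>z. 1 / 2 * (z \<bullet> (Q *v z)) - p \<bullet> z + r)"
    and sym: "transpose Q = Q" and stab: "(\<alpha>, \<beta>) \<in> stability_region Q"
    and AG: "AG_iterates M f \<alpha> \<beta> w x y" and noise: "noise_assumption M \<sigma> w x y"
    and v: "norm v = 1" "Q *v v = d *\<^sub>R v" and xs: "Q *v xs = p" and d: "d \<noteq> 0"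
  shows "integrable M (\<lambda>\<omega>. (v \<bullet> (x (int k) \<omega> - xs))\<^sup>2)"
    "(\<lambda>k. 1 / \<sigma>\<^sup>2 * (1 / 2 * (d * expectation (\<lambda>\<omega>. (v \<bullet> (x (int k) \<omega> - xs))\<^sup>2)))) \<longlonglongrightarrow> u_AG \<alpha> \<beta> d"
proof -
  define q where "q = 1 - \<alpha> * d"
  \<comment> \<open>Shifted by one: \<open>X 0\<close> belongs to \<open>x (- 1)\<close>, so the
    scalar recurrence starts at index 0. The shift is undone at the end through
    \<open>X (Suc k)\<close>.\<close>
  define X where "X = (\<lambda>k \<omega>. v \<bullet> (x (int k - 1) \<omega> - xs))"
  define \<eta> where "\<eta> = (\<lambda>k \<omega>. v \<bullet> w k \<omega>)"
  have \<sigma>: "\<sigma> > 0" and meas: "\<And>k. w k \<in> borel_measurable M"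
    and cov: "\<And>k. expectation (\<lambda>\<omega>. (\<chi> i j. w k \<omega> $ i * w k \<omega> $ j) :: real^'n^'n) = mat (\<sigma>\<^sup>2)"
    and const: "\<exists>c. \<forall>\<omega>\<in>space M. x 0 \<omega> = c" "\<exists>c. \<forall>\<omega>\<in>space M. x (- 1) \<omega> = c"
    using noise by (simp_all add: noise_assumption_def)
  have "\<sigma>\<^sup>2 \<noteq> 0" using \<sigma> by simp
  have v1: "v \<bullet> v = 1" using v(1) by (simp add: dot_square_norm)
  have sq\<eta>: "square_integrable M (\<eta> k)" and var\<eta>: "expectation (\<lambda>\<omega>. (\<eta> k \<omega>)\<^sup>2) = \<sigma>\<^sup>2" for k
    using isotropic_second_moment_inner[OF meas[of k] \<open>\<sigma>\<^sup>2 \<noteq> 0\<close> cov[of k], of v] by (simp_all add: \<eta>_def v1)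
  have rec: "X (k + 2) \<omega> = ((1 + \<beta>) * q) * X (k + 1) \<omega> - (\<beta> * q) * X k \<omega> - \<alpha> * \<eta> k \<omega>"
    if "\<omega> \<in> space M" for k \<omega>
  proof -
    have y: "y k \<omega> = (1 + \<beta>) *\<^sub>R x (int k) \<omega> - \<beta> *\<^sub>R x (int k - 1) \<omega>"
      and x: "x (int k + 1) \<omega> = y k \<omega> - \<alpha> *\<^sub>R (gradient f (y k \<omega>) + w k \<omega>)"
      using AG that by (simp_all add: AG_iterates_def)
    define u where "u = y k \<omega> - xs"
    have step: "x (int k + 1) \<omega> - xs = u - \<alpha> *\<^sub>R (Q *v u + w k \<omega>)"
      unfolding x f gradient_quadratic[OF sym] u_def
      by (simp add: xs[symmetric] matrix_vector_mult_diff_distrib)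
    have "v \<bullet> (Q *v u) = d * (v \<bullet> u)"
      using symmetric_matrix_inner[OF sym, of v u] v(2) by simp
    then have "v \<bullet> (x (int k + 1) \<omega> - xs) = q * (v \<bullet> u) - \<alpha> * (v \<bullet> w k \<omega>)"
      unfolding step by (simp add: inner_diff_right inner_add_right q_def algebra_simps)
    moreover have "v \<bullet> u = (1 + \<beta>) * X (k + 1) \<omega> - \<beta> * X k \<omega>"
      by (simp add: u_def y X_def inner_diff_right inner_add_right algebra_simps)
    ultimately show ?thesis by (simp add: X_def \<eta>_def algebra_simps)
  qed
  have sqc: "square_integrable M (\<lambda>\<omega>. v \<bullet> (x i \<omega> - xs))" if "\<exists>c. \<forall>\<omega>\<in>space M. x i \<omega> = c" for i
  proof -
    from that obtain c where c: "\<forall>\<omega>\<in>space M. x i \<omega> = c" ..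
    have "square_integrable M (\<lambda>\<omega>. v \<bullet> (x i \<omega> - xs)) \<longleftrightarrow> square_integrable M (\<lambda>_. v \<bullet> (c - xs))"
      by (rule square_integrable_cong) (simp only: c)
    then show ?thesis by (simp only: square_integrable_const)
  qed
  have sqX: "square_integrable M (X k)" for k
    by (rule AR2_square_integrable[where X = X and \<eta> = \<eta>, OF rec _ _ sq\<eta>])
      (simp_all add: X_def sqc const)
  have sqx: "square_integrable M (\<lambda>\<omega>. v \<bullet> (x i \<omega> - xs))" if "i \<ge> - 1" for i
    using sqX[of "nat (i + 1)"] that by (simp add: X_def)
  show "integrable M (\<lambda>\<omega>. (v \<bullet> (x (int k) \<omega> - xs))\<^sup>2)"
    using sqx[of "int k"] by (simp add: square_integrable_def)
  have uncorr: "expectation (\<lambda>\<omega>. \<eta> k \<omega> * X k \<omega>) = 0" "expectation (\<lambda>\<omega>. \<eta> k \<omega> * X (k + 1) \<omega>) = 0" for k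
    using noise_uncorrelated_with_iterates[OF noise sq\<eta>[unfolded \<eta>_def] sqx, of "int k - 1" k]
      noise_uncorrelated_with_iterates[OF noise sq\<eta>[unfolded \<eta>_def] sqx, of "int k" k]
    by (simp_all add: \<eta>_def X_def)
  have "v \<noteq> 0" using v(1) by auto
  have root: "norm z < 1" if "z\<^sup>2 = complex_of_real ((1 + \<beta>) * q) * z - complex_of_real (\<beta> * q)" for z
    using stability_region_characteristic_root[OF stab sym \<open>v \<noteq> 0\<close> v(2)] that by (simp only: q_def)
  note lim = AR2_expectation_square_tendsto[where X = X and \<eta> = \<eta>, OF rec sqX sq\<eta> var\<eta> uncorr root]
  have n1: "1 - \<beta> * q \<noteq> 0" using lim(1) .
  have e2: "1 - (1 + \<beta>) * q + \<beta> * q = \<alpha> * d" by (simp add: q_def algebra_simps)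
  have e3: "1 + (1 + \<beta>) * q + \<beta> * q = 2 + 2 * \<beta> - \<alpha> * d * (1 + 2 * \<beta>)" by (simp add: q_def algebra_simps)
  \<comment> \<open>Stability excludes \<alpha> = 0, for which 1 would be a characteristic root;
    this licenses cancelling one factor \<alpha>.\<close>
  have n2: "\<alpha> \<noteq> 0" using lim(2) unfolding e2 by auto
  have n3: "2 + 2 * \<beta> - \<alpha> * d * (1 + 2 * \<beta>) \<noteq> 0" using lim(3) unfolding e3 .
  have "(\<lambda>k. expectation (\<lambda>\<omega>. (X (Suc k) \<omega>)\<^sup>2)) \<longlonglongrightarrow>
      \<alpha>\<^sup>2 * \<sigma>\<^sup>2 * (1 + \<beta> * q) / ((1 - \<beta> * q) * (\<alpha> * d * (2 + 2 * \<beta> - \<alpha> * d * (1 + 2 * \<beta>))))"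
    using LIMSEQ_Suc[OF lim(4)] unfolding e2 e3 .
  then have "(\<lambda>k. 1 / \<sigma>\<^sup>2 * (1 / 2 * (d * expectation (\<lambda>\<omega>. (X (Suc k) \<omega>)\<^sup>2)))) \<longlonglongrightarrow> 1 / \<sigma>\<^sup>2 * (1 / 2 * (d *
      (\<alpha>\<^sup>2 * \<sigma>\<^sup>2 * (1 + \<beta> * q) / ((1 - \<beta> * q) * (\<alpha> * d * (2 + 2 * \<beta> - \<alpha> * d * (1 + 2 * \<beta>)))))))"
    by (intro tendsto_mult_left)
  moreover have "1 / \<sigma>\<^sup>2 * (1 / 2 * (d *
      (\<alpha>\<^sup>2 * \<sigma>\<^sup>2 * (1 + \<beta> * q) / ((1 - \<beta> * q) * (\<alpha> * d * (2 + 2 * \<beta> - \<alpha> * d * (1 + 2 * \<beta>)))))))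
      = u_AG \<alpha> \<beta> d"
  proof -
    have "1 / \<sigma>\<^sup>2 * (1 / 2 * (d * (\<alpha>\<^sup>2 * \<sigma>\<^sup>2 * N / (E * (\<alpha> * d * D))))) = \<alpha> * (N / (2 * E * D))"
      if "E \<noteq> 0" "D \<noteq> 0" for N E D :: real
      using that n2 d \<sigma> by (simp add: power2_eq_square field_simps)
    then show ?thesis using n1 n3 by (simp only: u_AG_def q_def not_False_eq_True)
  qed
  ultimately show "(\<lambda>k. 1 / \<sigma>\<^sup>2 * (1 / 2 * (d * expectation (\<lambda>\<omega>. (v \<bullet> (x (int k) \<omega> - xs))\<^sup>2))))
      \<longlonglongrightarrow> u_AG \<alpha> \<beta> d"
    by (simp add: X_def)
qed

theorem proposition3p7:
  fixes Q :: "real^'n^'n" and p :: "real^'n" and r \<mu> L \<alpha> \<beta> \<sigma> :: real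
    and lam :: "nat \<Rightarrow> real" and f :: "real^'n \<Rightarrow> real"
    and M :: "'a measure" and w y :: "nat \<Rightarrow> 'a \<Rightarrow> real^'n" and x :: "int \<Rightarrow> 'a \<Rightarrow> real^'n"
  assumes "f = (\<lambda>z. 1 / 2 * (z \<bullet> (Q *v z)) - p \<bullet> z + r)"
    and "sym_pos_def Q"
    and "ordered_eigenvalues Q lam"
    and "0 < \<mu>" and "\<mu> = lam 1" and "L = lam CARD('n)"
    and "(\<alpha>, \<beta>) \<in> stability_region Q"
    and "prob_space M"
    and "AG_iterates M f \<alpha> \<beta> w x y"
    and "noise_assumption M \<sigma> w x y"
  shows "robustness M \<sigma> f (\<lambda>k. x (int k)) = ereal (\<Sum>i = 1..CARD('n). u_AG \<alpha> \<beta> (lam i))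
    \<and> (\<beta> = 0 \<longrightarrow>
        robustness M \<sigma> f (\<lambda>k. x (int k)) = ereal (\<alpha> * (\<Sum>i = 1..CARD('n). 1 / (2 * (2 - \<alpha> * lam i)))))"
proof -
  interpret prob_space M by fact
  have sym: "transpose Q = Q" using assms(2) by (simp add: sym_pos_def_def)
  obtain v d where on: "\<And>i j :: 'n. v i \<bullet> v j = (if i = j then 1 else 0 :: real)"
    and ev: "\<And>i. Q *v v i = d i *\<^sub>R v i"
    using symmetric_matrix_eigenbasis[OF sym] by blast
  have nv: "norm (v i) = 1" for i using on[of i i] by (simp add: norm_eq_1)
  have d: "d i \<noteq> 0" for i
  proof -
    have "v i \<noteq> 0" using nv[of i] by auto
    then have "0 < v i \<bullet> (Q *v v i)" using assms(2) by (simp add: sym_pos_def_def)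
    then show ?thesis by (auto simp: ev)
  qed
  obtain xs where xs: "Q *v xs = p" using sym_pos_def_solution[OF assms(2)] .
  note mode = AG_mode_second_moment[OF assms(1) sym assms(7,9,10) nv ev xs d]
  have "1 / \<sigma>\<^sup>2 * expectation (\<lambda>\<omega>. f (x (int k) \<omega>) - min_value f)
     = (\<Sum>i\<in>UNIV. 1 / \<sigma>\<^sup>2 * (1 / 2 * (d i * expectation (\<lambda>\<omega>. (v i \<bullet> (x (int k) \<omega> - xs))\<^sup>2))))" for k
  proof -
    have "expectation (\<lambda>\<omega>. f (x (int k) \<omega>) - min_value f)
        = expectation (\<lambda>\<omega>. \<Sum>i\<in>UNIV. 1 / 2 * (d i * (v i \<bullet> (x (int k) \<omega> - xs))\<^sup>2))"
      unfolding min_value_quadratic[OF assms(2) xs assms(1)] quadratic_diff_eq[OF sym xs assms(1)]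
        quadratic_form_eigenbasis[OF sym on ev] sum_distrib_left ..
    also have "\<dots> = (\<Sum>i\<in>UNIV. 1 / 2 * (d i * expectation (\<lambda>\<omega>. (v i \<bullet> (x (int k) \<omega> - xs))\<^sup>2)))"
      by (subst Bochner_Integration.integral_sum) (auto simp: mode(1))
    finally show ?thesis by (simp only: sum_distrib_left)
  qed
  then have "(\<lambda>k. 1 / \<sigma>\<^sup>2 * expectation (\<lambda>\<omega>. f (x (int k) \<omega>) - min_value f))
      \<longlonglongrightarrow> (\<Sum>i\<in>UNIV. u_AG \<alpha> \<beta> (d i))"
    by (simp only:) (intro tendsto_sum mode(2))
  \<comment> \<open>Both \<open>d\<close> and \<open>lam\<close> factor the characteristic
    polynomial of \<open>Q\<close>, so they list the same eigenvalues with the same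
    multiplicities.\<close>
  also have "(\<Sum>i\<in>UNIV. u_AG \<alpha> \<beta> (d i)) = (\<Sum>i = 1..CARD('n). u_AG \<alpha> \<beta> (lam i))"
    using assms(3) det_eq_prod_eigenvalues[OF on ev]
    by (intro sum_cong_of_linear_factors) (auto simp: ordered_eigenvalues_def)
  finally have rob: "robustness M \<sigma> f (\<lambda>k. x (int k)) = ereal (\<Sum>i = 1..CARD('n). u_AG \<alpha> \<beta> (lam i))"
    unfolding robustness_def by (intro lim_imp_Limsup) auto
  have "u_AG \<alpha> 0 l = \<alpha> * (1 / (2 * (2 - \<alpha> * l)))" for l
    by (simp add: u_AG_def)
  then show ?thesis using rob by (simp add: sum_distrib_left)
qed

end
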